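(* Let $S$ be a finite set. Let $\mathrm{Semimat}(S)$ be the set of semimatroids on the ground set $S$, and let $\mathrm{MatId}(S)$ be the set of pairs $(M,\mathcal{I})$ of a matroid $M$ on $S$ and a modular ideal $\mathcal{I}$ of $M$. For a semimatroid $(S,\mathcal{C},r_{\mathcal{C}})$ let $M_{\mathcal{C}}=(S,r)$ with $r(X)=\max\{r_{\mathcal{C}}(Y) \mid Y\subseteq X,\ Y\in\mathcal{C}\}$ for all $X\subseteq S$. For $(M,\mathcal{I})\in \mathrm{MatId}(S)$ let $r_{\mathcal{I}}$ be the restriction of the rank function of $M$ to $\mathcal{I}$. Then: 1. The assignment $(S,\mathcal{C},r_{\mathcal{C}})\mapsto (M_{\mathcal{C}},\mathcal{C})$ is a map $\mathrm{Semimat}(S)\to\mathrm{MatId}(S)$ (that is, $r$ is the rank function of a matroid $M_{\mathcal{C}}$ on $S$, and $\mathcal{C}$ is a modular ideal of $M_{\mathcal{C}}$). 2. The assignment $(M,\mathcal{I})\mapsto (S,\mathcal{I},r_{\mathcal{I}})$ is a map $\mathrm{MatId}(S)\to\mathrm{Semimat}(S)$ (that is, $(S,\mathcal{I},r_{\mathcal{I}})$ is a semimatroid). 3. The two maps above are inverses of each other, and give a one-to-one correspondence between $\mathrm{Semimat}(S)$ and $\mathrm{MatId}(S)$.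
   Context: $\mathbb{N}$ includes $0$. A simplicial complex on a finite set $S$ is a family of subsets of $S$ closed under taking subsets; singletons $\{x\}$ with $x \in S$ need not belong to it. A semimatroid is a triple $(S,\mathcal{C},r_{\mathcal{C}})$ consisting of a finite set $S$ (ground set), a non-empty simplicial complex $\mathcal{C}$ on $S$ (the central sets), and a function $r_{\mathcal{C}}:\mathcal{C}\to\mathbb{N}$ (rank function) such that: (R1) if $X\in\mathcal{C}$ then $0\le r_{\mathcal{C}}(X)\le |X|$; (R2) if $X,Y\in\mathcal{C}$ and $X\subseteq Y$ then $r_{\mathcal{C}}(X)\le r_{\mathcal{C}}(Y)$; (R3) if $X,Y\in\mathcal{C}$ and $X\cup Y\in\mathcal{C}$ then $r_{\mathcal{C}}(X)+r_{\mathcal{C}}(Y)\ge r_{\mathcal{C}}(X\cup Y)+r_{\mathcal{C}}(X\cap Y)$; (CR1) if $X,Y\in\mathcal{C}$ and $r_{\mathcal{C}}(X)=r_{\mathcal{C}}(X\cap Y)$ then $X\cup Y\in\mathcal{C}$; (CR2) if $X,Y\in\mathcal{C}$ and $r_{\mathcal{C}}(X)<r_{\mathcal{C}}(Y)$ then $X\cup\{y\}\in\mathcal{C}$ for some $y\in Y-X$. A matroid $M=(S,r)$ is given by a finite set $S$ and its rank function $r:2^S\to\mathbb{N}$. A pair $\{X,Y\}$ of subsets of $S$ is a modular pair of $M$ if $r(X)+r(Y)=r(X\cup Y)+r(X\cap Y)$. A modular ideal $\mathcal{I}$ of $M$ is a non-empty collection of subsets of $S$ such that: (MI1) $\mathcal{I}$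 is a simplicial complex; (MI2) $\{a\}\in\mathcal{I}$ for every non-loop $a$ of $M$; (MI3) if $\{X,Y\}$ is a modular pair in $M$ and $X,Y\in\mathcal{I}$, then $X\cup Y\in\mathcal{I}$. *)

theory Defs
  imports Main "HOL-Library.FuncSet"
begin

definition simplicial_complex_on :: "'a set \<Rightarrow> 'a set set \<Rightarrow> bool" where
  "simplicial_complex_on S C \<longleftrightarrow>
     C \<subseteq> Pow S \<and> (\<forall>X\<in>C. \<forall>Y. Y \<subseteq> X \<longrightarrow> Y \<in> C)"

(* Rank functions are extensional (they take the value undefined outside their domain), so that
   equality in HOL is equality of functions on the domain. *)

definition semimatroid :: "'a set \<Rightarrow> 'a set set \<Rightarrow> ('a set \<Rightarrow> nat) \<Rightarrow> bool" where
  "semimatroid S C rC \<longleftrightarrow>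
     finite S \<and> C \<noteq> {} \<and> simplicial_complex_on S C \<and> rC \<in> C \<rightarrow>\<^sub>E UNIV \<and>
     (\<forall>X\<in>C. 0 \<le> rC X \<and> rC X \<le> card X) \<and>
     (\<forall>X\<in>C. \<forall>Y\<in>C. X \<subseteq> Y \<longrightarrow> rC X \<le> rC Y) \<and>
     (\<forall>X\<in>C. \<forall>Y\<in>C. X \<union> Y \<in> C \<longrightarrow> rC X + rC Y \<ge> rC (X \<union> Y) + rC (X \<inter> Y)) \<and>
     (\<forall>X\<in>C. \<forall>Y\<in>C. rC X = rC (X \<inter> Y) \<longrightarrow> X \<union> Y \<in> C) \<and>
     (\<forall>X\<in>C. \<forall>Y\<in>C. rC X < rC Y \<longrightarrow> (\<exists>y\<in>Y - X. X \<union> {y} \<in> C))"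

definition matroid :: "'a set \<Rightarrow> ('a set \<Rightarrow> nat) \<Rightarrow> bool" where
  "matroid S r \<longleftrightarrow>
     finite S \<and> r \<in> Pow S \<rightarrow>\<^sub>E UNIV \<and>
     (\<forall>X\<in>Pow S. 0 \<le> r X \<and> r X \<le> card X) \<and>
     (\<forall>X\<in>Pow S. \<forall>Y\<in>Pow S. X \<subseteq> Y \<longrightarrow> r X \<le> r Y) \<and>
     (\<forall>X\<in>Pow S. \<forall>Y\<in>Pow S. r X + r Y \<ge> r (X \<union> Y) + r (X \<inter> Y))"

definition loop :: "'a set \<Rightarrow> ('a set \<Rightarrow> nat) \<Rightarrow> 'a \<Rightarrow> bool" where
  "loop S r a \<longleftrightarrow> a \<in> S \<and> r {a} = 0"

definition modular_pair :: "'a set \<Rightarrow> ('a set \<Rightarrow> nat) \<Rightarrow> 'a set \<Rightarrow> 'a set \<Rightarrow> bool" where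
  "modular_pair S r X Y \<longleftrightarrow>
     X \<subseteq> S \<and> Y \<subseteq> S \<and> r X + r Y = r (X \<union> Y) + r (X \<inter> Y)"

definition modular_ideal :: "'a set \<Rightarrow> ('a set \<Rightarrow> nat) \<Rightarrow> 'a set set \<Rightarrow> bool" where
  "modular_ideal S r I \<longleftrightarrow>
     I \<noteq> {} \<and>
     simplicial_complex_on S I \<and>
     (\<forall>a\<in>S. \<not> loop S r a \<longrightarrow> {a} \<in> I) \<and>
     (\<forall>X\<in>I. \<forall>Y\<in>I. modular_pair S r X Y \<longrightarrow> X \<union> Y \<in> I)"

definition Semimat :: "'a set \<Rightarrow> ('a set \<times> 'a set set \<times> ('a set \<Rightarrow> nat)) set" where
  "Semimat S = {(S, C, rC) | C rC. semimatroid S C rC}"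

definition MatId :: "'a set \<Rightarrow> (('a set \<times> ('a set \<Rightarrow> nat)) \<times> 'a set set) set" where
  "MatId S = {((S, r), I) | r I. matroid S r \<and> modular_ideal S r I}"

fun matroid_of :: "'a set \<times> 'a set set \<times> ('a set \<Rightarrow> nat) \<Rightarrow> 'a set \<times> ('a set \<Rightarrow> nat)" where
  "matroid_of (S, C, rC) = (S, \<lambda>X\<in>Pow S. Max {rC Y | Y. Y \<subseteq> X \<and> Y \<in> C})"

fun to_MatId ::
  "'a set \<times> 'a set set \<times> ('a set \<Rightarrow> nat) \<Rightarrow> ('a set \<times> ('a set \<Rightarrow> nat)) \<times> 'a set set" where
  "to_MatId (S, C, rC) = (matroid_of (S, C, rC), C)"

fun to_Semimat ::
  "('a set \<times> ('a set \<Rightarrow> nat)) \<times> 'a set set \<Rightarrow> 'a set \<times> 'a set set \<times> ('a set \<Rightarrow> nat)" where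
  "to_Semimat ((S, r), I) = (S, I, restrict r I)"

end

theory Submission
  imports Defs
begin

text \<open>
  Axiom (CR2) can be strengthened so that the added element raises the rank, hence every central
  subset of \<open>X\<close> extends to a central subset of \<open>X\<close> of maximal rank. Extending such a set from
  \<open>X \<inter> Y\<close> to \<open>X \<union> Y\<close> reduces submodularity of \<open>r\<close> to (R3). Extending \<open>X\<close> itself to
  \<open>B \<subseteq> X \<union> Y\<close>, modularity of \<open>X, Y\<close> forces \<open>B \<inter> Y\<close> to have the rank of \<open>Y\<close>, so that
  \<open>Y \<union> B = X \<union> Y\<close> is central by (CR1). Conversely, in a modular ideal, adding to a member an
  element that raises the rank is the union of a modular pair, which gives (CR2) and shows that
  the ranks on the ideal determine the matroid.
\<close>

text \<open>This is the rank function of \<open>matroid_of\<close> before the restriction to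
  \<open>Pow S\<close>. Being total, it is monotone and submodular without side conditions
  \<open>X \<subseteq> S\<close>.\<close>

definition central_rank :: "'a set set \<Rightarrow> ('a set \<Rightarrow> nat) \<Rightarrow> 'a set \<Rightarrow> nat" where
  "central_rank C rC X = Max {rC Y | Y. Y \<subseteq> X \<and> Y \<in> C}"

section \<open>From semimatroids to modular ideals\<close>

lemma semimatroidD:
  assumes "semimatroid S C rC"
  shows semimatroid_finite: "finite S"
    and semimatroid_subset: "X \<in> C \<Longrightarrow> X \<subseteq> S"
    and semimatroid_down: "\<lbrakk>X \<in> C; Y \<subseteq> X\<rbrakk> \<Longrightarrow> Y \<in> C"
    and semimatroid_extensional: "rC \<in> C \<rightarrow>\<^sub>E UNIV"
    and semimatroid_le_card: "X \<in> C \<Longrightarrow> rC X \<le> card X"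
    and semimatroid_mono: "\<lbrakk>X \<in> C; Y \<in> C; X \<subseteq> Y\<rbrakk> \<Longrightarrow> rC X \<le> rC Y"
    and semimatroid_submodular:
      "\<lbrakk>X \<in> C; Y \<in> C; X \<union> Y \<in> C\<rbrakk> \<Longrightarrow> rC (X \<union> Y) + rC (X \<inter> Y) \<le> rC X + rC Y"
    and semimatroid_CR1: "\<lbrakk>X \<in> C; Y \<in> C; rC X = rC (X \<inter> Y)\<rbrakk> \<Longrightarrow> X \<union> Y \<in> C"
    and semimatroid_CR2:
      "\<lbrakk>X \<in> C; Y \<in> C; rC X < rC Y\<rbrakk> \<Longrightarrow> \<exists>y\<in>Y - X. X \<union> {y} \<in> C"
    and semimatroid_empty: "{} \<in> C"
proof -
  have *: "finite S" "simplicial_complex_on S C" "C \<noteq> {}"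
    using assms by (simp_all add: semimatroid_def)
  show "finite S" by fact
  show "X \<in> C \<Longrightarrow> X \<subseteq> S" "{} \<in> C" "\<lbrakk>X \<in> C; Y \<subseteq> X\<rbrakk> \<Longrightarrow> Y \<in> C"
    using * by (auto simp: simplicial_complex_on_def)
  show "rC \<in> C \<rightarrow>\<^sub>E UNIV" using assms by (simp add: semimatroid_def)
  show "X \<in> C \<Longrightarrow> rC X \<le> card X" using assms by (simp add: semimatroid_def)
  show "\<lbrakk>X \<in> C; Y \<in> C; X \<subseteq> Y\<rbrakk> \<Longrightarrow> rC X \<le> rC Y"
    using assms unfolding semimatroid_def by metis
  show "\<lbrakk>X \<in> C; Y \<in> C; X \<union> Y \<in> C\<rbrakk> \<Longrightarrow> rC (X \<union> Y) + rC (X \<inter> Y) \<le> rC X + rC Y"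
    using assms unfolding semimatroid_def by metis
  show "\<lbrakk>X \<in> C; Y \<in> C; rC X = rC (X \<inter> Y)\<rbrakk> \<Longrightarrow> X \<union> Y \<in> C"
    using assms unfolding semimatroid_def by metis
  show "\<lbrakk>X \<in> C; Y \<in> C; rC X < rC Y\<rbrakk> \<Longrightarrow> \<exists>y\<in>Y - X. X \<union> {y} \<in> C"
    using assms unfolding semimatroid_def by metis
qed

text \<open>(CR2) applied to \<open>X\<close> itself may add an element that leaves the rank
  unchanged. It is therefore applied to a maximal central \<open>Z\<close> between \<open>X\<close>
  and \<open>X \<union> Y\<close> with the rank of \<open>X\<close>: there the new element must
  raise the rank.\<close>

lemma semimatroid_augment:
  assumes sm: "semimatroid S C rC" and X: "X \<in> C" and Y: "Y \<in> C" and lt: "rC X < rC Y"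
  obtains y where "y \<in> Y - X" "insert y X \<in> C" "rC X < rC (insert y X)"
proof -
  define F where "F = {Z \<in> C. X \<subseteq> Z \<and> Z \<subseteq> X \<union> Y \<and> rC Z = rC X}"
  have "finite (X \<union> Y)"
    using semimatroid_finite[OF sm] semimatroid_subset[OF sm] X Y by (meson finite_Un finite_subset)
  then have "finite F" by (rule rev_finite_subset[OF finite_Pow_iff[THEN iffD2]]) (auto simp: F_def)
  moreover have "X \<in> F" using X by (simp add: F_def)
  ultimately obtain Z where Z: "Z \<in> F" and max: "\<And>W. W \<in> F \<Longrightarrow> Z \<subseteq> W \<Longrightarrow> Z = W"
    using finite_has_maximal[of F] by blast
  from Z have ZC: "Z \<in> C" and XZ: "X \<subseteq> Z" "Z \<subseteq> X \<union> Y" and rZ: "rC Z = rC X"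
    by (auto simp: F_def)
  obtain y where y: "y \<in> Y - Z" and yZ: "insert y Z \<in> C"
    using semimatroid_CR2[OF sm ZC Y] lt rZ by auto
  have yX: "insert y X \<in> C" using semimatroid_down[OF sm yZ] XZ by blast
  have "insert y Z \<notin> F" using max[of "insert y Z"] y by blast
  then have "rC (insert y Z) \<noteq> rC X" using XZ y yZ by (auto simp: F_def)
  moreover have "rC X \<le> rC (insert y Z)" using semimatroid_mono[OF sm X yZ] XZ by blast
  \<comment> \<open>By (R3) the gain of \<open>y\<close> over \<open>X\<close> is at least its gain
    over the larger set \<open>Z\<close>.\<close>
  moreover have "insert y X \<union> Z = insert y Z" "insert y X \<inter> Z = X" using XZ y by auto
  then have "rC (insert y Z) + rC X \<le> rC (insert y X) + rC Z"
    using semimatroid_submodular[OF sm yX ZC] yZ by simp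
  ultimately show thesis using that[of y] y yX XZ rZ by auto
qed

lemma finite_central_ranks:
  assumes "semimatroid S C rC"
  shows "finite {rC Y | Y. Y \<subseteq> X \<and> Y \<in> C}"
proof -
  have "C \<subseteq> Pow S" using semimatroid_subset[OF assms] by blast
  then have "finite C" using semimatroid_finite[OF assms] finite_subset by blast
  then show ?thesis by simp
qed

lemma central_rank_ge:
  assumes "semimatroid S C rC" "Y \<subseteq> X" "Y \<in> C"
  shows "rC Y \<le> central_rank C rC X"
  unfolding central_rank_def using finite_central_ranks[OF assms(1)] assms(2,3)
  by (intro Max_ge) auto

lemma central_rank_attained:
  assumes "semimatroid S C rC"
  obtains Y where "Y \<subseteq> X" "Y \<in> C" "rC Y = central_rank C rC X"
proof -
  have "central_rank C rC X \<in> {rC Y | Y. Y \<subseteq> X \<and> Y \<in> C}"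
    unfolding central_rank_def using semimatroid_empty[OF assms]
    by (intro Max_in finite_central_ranks[OF assms]) auto
  then show thesis using that by auto
qed

lemma central_rank_eq:
  assumes sm: "semimatroid S C rC" and X: "X \<in> C"
  shows "central_rank C rC X = rC X"
proof (rule antisym)
  obtain Y where "Y \<subseteq> X" "Y \<in> C" "rC Y = central_rank C rC X"
    by (rule central_rank_attained[OF sm])
  then show "central_rank C rC X \<le> rC X" using semimatroid_mono[OF sm _ X, of Y] by simp
  show "rC X \<le> central_rank C rC X" by (rule central_rank_ge[OF sm subset_refl X])
qed

lemma central_rank_mono:
  assumes sm: "semimatroid S C rC" and "X \<subseteq> Y"
  shows "central_rank C rC X \<le> central_rank C rC Y"
proof -
  obtain Z where "Z \<subseteq> X" "Z \<in> C" "rC Z = central_rank C rC X"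
    by (rule central_rank_attained[OF sm])
  then show ?thesis using central_rank_ge[OF sm, of Z Y] \<open>X \<subseteq> Y\<close> by simp
qed

text \<open>Take a set of greatest rank among the central sets between \<open>B\<close> and
  \<open>X\<close>. If its rank fell short of the maximum over all central subsets of
  \<open>X\<close>, \<open>semimatroid_augment\<close> would enlarge it inside \<open>X\<close> and
  raise its rank.\<close>

lemma central_extension:
  assumes sm: "semimatroid S C rC" and B: "B \<in> C" "B \<subseteq> X"
  obtains B' where "B' \<in> C" "B \<subseteq> B'" "B' \<subseteq> X" "rC B' = central_rank C rC X"
proof -
  define P where "P Z \<longleftrightarrow> Z \<in> C \<and> B \<subseteq> Z \<and> Z \<subseteq> X" for Z
  have "\<forall>Z. P Z \<longrightarrow> rC Z < Suc (central_rank C rC X)"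
    using central_rank_ge[OF sm] by (simp add: P_def less_Suc_eq_le)
  moreover have "P B" using B by (simp add: P_def)
  ultimately have "\<exists>Z. P Z \<and> (\<forall>W. P W \<longrightarrow> rC W \<le> rC Z)"
    by (intro ex_has_greatest_nat)
  then obtain Z where Z: "P Z" and max: "\<And>W. P W \<Longrightarrow> rC W \<le> rC Z" by blast
  obtain Y where Y: "Y \<subseteq> X" "Y \<in> C" "rC Y = central_rank C rC X"
    by (rule central_rank_attained[OF sm])
  have "\<not> rC Z < rC Y"
  proof
    assume "rC Z < rC Y"
    then obtain y where y: "y \<in> Y - Z" "insert y Z \<in> C" "rC Z < rC (insert y Z)"
      by (rule semimatroid_augment[OF sm conjunct1[OF Z[unfolded P_def]] Y(2)])
    then have "P (insert y Z)" using Z Y(1) by (auto simp: P_def)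
    then have "rC (insert y Z) \<le> rC Z" by (rule max)
    then show False using y(3) by simp
  qed
  moreover have "rC Z \<le> central_rank C rC X" using central_rank_ge[OF sm] Z by (simp add: P_def)
  ultimately show thesis using that[of Z] Z Y(3) by (simp add: P_def)
qed

lemma central_rank_submodular:
  assumes sm: "semimatroid S C rC"
  shows "central_rank C rC (X \<union> Y) + central_rank C rC (X \<inter> Y)
    \<le> central_rank C rC X + central_rank C rC Y"
proof -
  obtain B where B: "B \<subseteq> X \<inter> Y" "B \<in> C" "rC B = central_rank C rC (X \<inter> Y)"
    by (rule central_rank_attained[OF sm])
  then obtain B' where B': "B' \<in> C" "B \<subseteq> B'" "B' \<subseteq> X \<union> Y" "rC B' = central_rank C rC (X \<union> Y)"
    using central_extension[OF sm, of B "X \<union> Y"] by blast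
  have down: "Z \<in> C" if "Z \<subseteq> B'" for Z using semimatroid_down[OF sm B'(1) that] .
  \<comment> \<open>\<open>X\<close> and \<open>Y\<close> need not be central, but their traces on
    \<open>B'\<close> are, and so is the union \<open>B'\<close> of the traces; hence (R3)
    applies.\<close>
  have "(B' \<inter> X) \<union> (B' \<inter> Y) = B'" using B'(3) by blast
  then have "rC B' + rC ((B' \<inter> X) \<inter> (B' \<inter> Y)) \<le> rC (B' \<inter> X) + rC (B' \<inter> Y)"
    using semimatroid_submodular[OF sm, of "B' \<inter> X" "B' \<inter> Y"] down B'(1) by simp
  moreover have "rC B \<le> rC ((B' \<inter> X) \<inter> (B' \<inter> Y))"
  proof (rule semimatroid_mono[OF sm B(2)])
    show "(B' \<inter> X) \<inter> (B' \<inter> Y) \<in> C" by (rule down) blast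
    show "B \<subseteq> (B' \<inter> X) \<inter> (B' \<inter> Y)" using B(1) B'(2) by blast
  qed
  moreover have "rC (B' \<inter> Z) \<le> central_rank C rC Z" for Z
    by (rule central_rank_ge[OF sm Int_lower2 down[OF Int_lower1]])
  note this[of X] this[of Y]
  ultimately show ?thesis using B(3) B'(4) by linarith
qed

lemma matroid_central_rank:
  assumes sm: "semimatroid S C rC"
  shows "matroid S (restrict (central_rank C rC) (Pow S))"
proof -
  have "central_rank C rC X \<le> card X" if X: "X \<subseteq> S" for X
  proof -
    obtain Y where Y: "Y \<subseteq> X" "Y \<in> C" "rC Y = central_rank C rC X"
      by (rule central_rank_attained[OF sm])
    then have "central_rank C rC X \<le> card Y" using semimatroid_le_card[OF sm, of Y] by simp
    also have "\<dots> \<le> card X"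
      using X Y(1) semimatroid_finite[OF sm] by (meson card_mono finite_subset)
    finally show ?thesis .
  qed
  \<comment> \<open>Lets the restriction to \<open>Pow S\<close> be evaluated at
    intersections.\<close>
  moreover have "X \<inter> Y \<subseteq> S" if "X \<subseteq> S" for X Y using that by blast
  ultimately show ?thesis
    using semimatroid_finite[OF sm] central_rank_mono[OF sm] central_rank_submodular[OF sm]
    by (simp add: matroid_def)
qed

lemma modular_ideal_central:
  assumes sm: "semimatroid S C rC"
  shows "modular_ideal S (restrict (central_rank C rC) (Pow S)) C"
proof -
  let ?r = "restrict (central_rank C rC) (Pow S)"
  have r: "?r X = rC X" if "X \<in> C" for X
    using central_rank_eq[OF sm that] semimatroid_subset[OF sm that] by simp
  have "{a} \<in> C" if a: "a \<in> S" "\<not> loop S ?r a" for a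
  proof -
    obtain Y where Y: "Y \<subseteq> {a}" "Y \<in> C" "rC Y = central_rank C rC {a}"
      by (rule central_rank_attained[OF sm])
    \<comment> \<open>A central subset of \<open>{a}\<close> of positive rank is non-empty, hence
      equal to \<open>{a}\<close>.\<close>
    have "rC Y \<noteq> 0" using a Y(3) by (simp add: loop_def)
    then have "Y \<noteq> {}" using semimatroid_le_card[OF sm Y(2)] by auto
    then show ?thesis using Y(1,2) by (metis subset_singletonD)
  qed
  moreover have "X \<union> Y \<in> C" if X: "X \<in> C" and Y: "Y \<in> C" and m: "modular_pair S ?r X Y" for X Y
  proof -
    \<comment> \<open>\<open>B\<close> is a central substitute of full rank for
      \<open>X \<union> Y\<close>, which is not yet known to be central.\<close>
    obtain B where B: "B \<in> C" "X \<subseteq> B" "B \<subseteq> X \<union> Y" "rC B = central_rank C rC (X \<union> Y)"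
      by (rule central_extension[OF sm X Un_upper1])
    have XY: "X \<inter> Y \<in> C" and BY: "B \<inter> Y \<in> C"
      by (rule semimatroid_down[OF sm Y Int_lower2])+
    have "X \<union> Y \<subseteq> S" using m by (simp add: modular_pair_def)
    then have "rC X + rC Y = rC B + rC (X \<inter> Y)"
      using m r[OF X] r[OF Y] r[OF XY] B(4) by (simp add: modular_pair_def)
    \<comment> \<open>Submodularity for \<open>X\<close> and \<open>B \<inter> Y\<close>, compared
      with the modular equation, leaves \<open>rC Y \<le> rC (B \<inter> Y)\<close>. This is what
      (CR1) needs for \<open>Y\<close> and \<open>B\<close>.\<close>
    moreover have *: "X \<union> (B \<inter> Y) = B" "X \<inter> (B \<inter> Y) = X \<inter> Y" using B(2,3) by auto
    have "rC B + rC (X \<inter> Y) \<le> rC X + rC (B \<inter> Y)"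
      using semimatroid_submodular[OF sm X BY] B(1) unfolding * by simp
    moreover have "rC (B \<inter> Y) \<le> rC Y" using semimatroid_mono[OF sm BY Y] by simp
    ultimately have "rC Y = rC (Y \<inter> B)" by (simp add: Int_commute)
    then have "Y \<union> B \<in> C" by (rule semimatroid_CR1[OF sm Y B(1)])
    then show ?thesis by (rule semimatroid_down[OF sm]) (use B(2) in blast)
  qed
  moreover have "C \<noteq> {}" "simplicial_complex_on S C" using sm by (simp_all add: semimatroid_def)
  ultimately show ?thesis unfolding modular_ideal_def by (intro conjI ballI impI)
qed

section \<open>From modular ideals to semimatroids\<close>

lemma matroidD:
  assumes "matroid S r"
  shows matroid_finite: "finite S"
    and matroid_extensional: "r \<in> Pow S \<rightarrow>\<^sub>E UNIV"
    and matroid_le_card: "X \<subseteq> S \<Longrightarrow> r X \<le> card X"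
    and matroid_mono: "\<lbrakk>X \<subseteq> Y; Y \<subseteq> S\<rbrakk> \<Longrightarrow> r X \<le> r Y"
    and matroid_submodular:
      "\<lbrakk>X \<subseteq> S; Y \<subseteq> S\<rbrakk> \<Longrightarrow> r (X \<union> Y) + r (X \<inter> Y) \<le> r X + r Y"
  using assms by (auto simp: matroid_def)

lemma modular_idealD:
  assumes "modular_ideal S r I"
  shows modular_ideal_subset: "X \<in> I \<Longrightarrow> X \<subseteq> S"
    and modular_ideal_down: "\<lbrakk>X \<in> I; Y \<subseteq> X\<rbrakk> \<Longrightarrow> Y \<in> I"
    and modular_ideal_nonloop: "\<lbrakk>a \<in> S; \<not> loop S r a\<rbrakk> \<Longrightarrow> {a} \<in> I"
    and modular_ideal_union: "\<lbrakk>X \<in> I; Y \<in> I; modular_pair S r X Y\<rbrakk> \<Longrightarrow> X \<union> Y \<in> I"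
  using assms by (auto simp: modular_ideal_def simplicial_complex_on_def)

text \<open>If no single element of \<open>Y\<close> raises the rank of \<open>X\<close>, then
  adding all of \<open>Y\<close> one element at a time does not raise it either.\<close>

lemma matroid_augment:
  assumes M: "matroid S r" and X: "X \<subseteq> S" and Y: "Y \<subseteq> S" and lt: "r X < r Y"
  obtains y where "y \<in> Y - X" "r X < r (insert y X)"
proof (rule ccontr)
  assume "\<not> thesis"
  then have stuck: "\<And>y. y \<in> Y - X \<Longrightarrow> r (insert y X) \<le> r X"
    using that by (meson not_le)
  have "finite Y" using Y matroid_finite[OF M] finite_subset by blast
  \<comment> \<open>\<open>stuck\<close> and \<open>Y \<subseteq> S\<close> pass to subsets of
    \<open>Y\<close>, so both are carried through the induction.\<close>
  then have "r (X \<union> Y) \<le> r X" using stuck Y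
  proof (induction Y rule: finite_induct)
    case (insert y F)
    have F: "r (X \<union> F) \<le> r X" using insert by blast
    show ?case
    proof (cases "y \<in> X")
      case True
      then show ?thesis using F by (simp add: insert_absorb)
    next
      case False
      then have yX: "r (insert y X) \<le> r X" using insert.prems by simp
      \<comment> \<open>The gain of \<open>y\<close> over \<open>X \<union> F\<close> is at most its
        gain over \<open>X\<close>, which is zero.\<close>
      have *: "insert y X \<union> (X \<union> F) = X \<union> insert y F" "insert y X \<inter> (X \<union> F) = X"
        using False insert.hyps by auto
      have "r (X \<union> insert y F) + r X \<le> r (insert y X) + r (X \<union> F)"
        using matroid_submodular[OF M, of "insert y X" "X \<union> F"] X insert.prems unfolding * by simp
      then show ?thesis using F yX by linarith
    qed
  qed simp
  moreover have "r Y \<le> r (X \<union> Y)" using X Y by (intro matroid_mono[OF M]) auto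
  ultimately show False using lt by linarith
qed

text \<open>The gain of \<open>y\<close> over \<open>X\<close> is at least 1 and at most
  \<open>r {y} \<le> 1\<close>. So \<open>y\<close> is not a loop, and \<open>X\<close> and
  \<open>{y}\<close> are disjoint and form a modular pair.\<close>

lemma modular_ideal_insert:
  assumes M: "matroid S r" and I: "modular_ideal S r I"
    and X: "X \<in> I" and y: "y \<in> S" and lt: "r X < r (insert y X)"
  shows "insert y X \<in> I"
proof -
  have XS: "X \<subseteq> S" using modular_ideal_subset[OF I X] .
  have yX: "y \<notin> X" using lt by (auto simp: insert_absorb)
  have r0: "r {} = 0" using matroid_le_card[OF M, of "{}"] by simp
  have "r (insert y X) \<le> r X + r {y}"
    using matroid_submodular[OF M XS, of "{y}"] y yX r0 by simp
  moreover have "r {y} \<le> 1" using matroid_le_card[OF M, of "{y}"] y by simp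
  ultimately have "r {y} = 1" "r (insert y X) = r X + r {y}" using lt by auto
  then have "{y} \<in> I" "modular_pair S r X {y}"
    using modular_ideal_nonloop[OF I y] XS y yX r0 by (auto simp: loop_def modular_pair_def)
  then show ?thesis using modular_ideal_union[OF I X] by fastforce
qed

lemma semimatroid_modular_ideal:
  assumes M: "matroid S r" and I: "modular_ideal S r I"
  shows "semimatroid S I (restrict r I)"
proof -
  note sub = modular_ideal_subset[OF I] and down = modular_ideal_down[OF I]
  have "X \<union> Y \<in> I" if X: "X \<in> I" and Y: "Y \<in> I" and eq: "r X = r (X \<inter> Y)" for X Y
  proof -
    \<comment> \<open>The hypothesis of (CR1) reduces submodularity to
      \<open>r (X \<union> Y) \<le> r Y\<close>; monotonicity makes it an equality, so the pair is
      modular.\<close>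
    have "r (X \<union> Y) + r (X \<inter> Y) \<le> r X + r Y"
      using matroid_submodular[OF M] sub X Y by blast
    moreover have "r Y \<le> r (X \<union> Y)" using matroid_mono[OF M] sub X Y by simp
    ultimately have "modular_pair S r X Y" using eq sub X Y by (simp add: modular_pair_def)
    then show ?thesis by (rule modular_ideal_union[OF I X Y])
  qed
  moreover have "\<exists>y\<in>Y - X. insert y X \<in> I" if X: "X \<in> I" and Y: "Y \<in> I" and lt: "r X < r Y" for X Y
  proof -
    \<comment> \<open>For (CR2), an element is chosen that raises the rank, since such an element
      can be added within the ideal.\<close>
    obtain y where "y \<in> Y - X" "r X < r (insert y X)"
      by (rule matroid_augment[OF M sub[OF X] sub[OF Y] lt])
    then show ?thesis using modular_ideal_insert[OF M I X, of y] sub[OF Y] by blast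
  qed
  moreover have "X \<inter> Y \<in> I" if "X \<in> I" for X Y using down that by blast
  moreover have "r (X \<union> Y) + r (X \<inter> Y) \<le> r X + r Y" if "X \<in> I" "Y \<in> I" for X Y
    using matroid_submodular[OF M] sub that by blast
  moreover have "r X \<le> card X" if "X \<in> I" for X using matroid_le_card[OF M] sub that by blast
  moreover have "r X \<le> r Y" if "X \<subseteq> Y" "Y \<in> I" for X Y
    using matroid_mono[OF M] sub that by blast
  moreover have "I \<noteq> {}" "simplicial_complex_on S I" using I by (auto simp: modular_ideal_def)
  ultimately show ?thesis
    unfolding semimatroid_def using matroid_finite[OF M]
    by (intro conjI ballI impI) (auto simp del: Int_iff)
qed

text \<open>A member of the ideal inside \<open>X\<close> with rank below \<open>r X\<close> could
  be enlarged inside \<open>X\<close> to a member of higher rank, so members of the ideal already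
  attain \<open>r X\<close>.\<close>

lemma central_rank_modular_ideal:
  assumes M: "matroid S r" and I: "modular_ideal S r I" and X: "X \<subseteq> S"
  shows "central_rank I (restrict r I) X = r X"
proof -
  have sm: "semimatroid S I (restrict r I)" by (rule semimatroid_modular_ideal[OF M I])
  obtain Y where Y: "Y \<subseteq> X" "Y \<in> I" "restrict r I Y = central_rank I (restrict r I) X"
    by (rule central_rank_attained[OF sm])
  have "\<not> r Y < r X"
  proof
    assume "r Y < r X"
    then obtain y where y: "y \<in> X - Y" "r Y < r (insert y Y)"
      using matroid_augment[OF M modular_ideal_subset[OF I Y(2)] X] by blast
    then have yY: "insert y Y \<in> I" using modular_ideal_insert[OF M I Y(2)] X by blast
    then have "restrict r I (insert y Y) \<le> restrict r I Y"
      unfolding Y(3) using y(1) Y(1) by (intro central_rank_ge[OF sm]) auto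
    then show False using y(2) yY Y(2) by simp
  qed
  moreover have "r Y \<le> r X" using matroid_mono[OF M Y(1) X] .
  ultimately show ?thesis using Y(2,3) by simp
qed

section \<open>The correspondence\<close>

lemma to_MatId_eq:
  "to_MatId (S, C, rC) = ((S, restrict (central_rank C rC) (Pow S)), C)"
  by (simp add: central_rank_def[abs_def])

theorem theorem3p6:
  fixes S :: "'a set"
  assumes "finite S"
  shows "to_MatId \<in> Semimat S \<rightarrow> MatId S \<and>
         to_Semimat \<in> MatId S \<rightarrow> Semimat S \<and>
         (\<forall>A\<in>Semimat S. to_Semimat (to_MatId A) = A) \<and>
         (\<forall>B\<in>MatId S. to_MatId (to_Semimat B) = B) \<and>
         bij_betw to_MatId (Semimat S) (MatId S) \<and>
         bij_betw to_Semimat (MatId S) (Semimat S)"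
proof -
  \<comment> \<open>The defining equation of \<open>to_MatId\<close> is switched off so that
    \<open>to_MatId_eq\<close> brings in \<open>central_rank\<close>.\<close>
  have 1: "to_MatId \<in> Semimat S \<rightarrow> MatId S"
    using matroid_central_rank modular_ideal_central
    by (auto simp: Semimat_def MatId_def to_MatId_eq simp del: to_MatId.simps)
  have 2: "to_Semimat \<in> MatId S \<rightarrow> Semimat S"
    using semimatroid_modular_ideal by (auto simp: Semimat_def MatId_def)
  have 3: "to_Semimat (to_MatId A) = A" if A: "A \<in> Semimat S" for A
  proof -
    obtain C rC where A: "A = (S, C, rC)" and sm: "semimatroid S C rC"
      using A by (auto simp: Semimat_def)
    \<comment> \<open>Since \<open>C \<subseteq> Pow S\<close>, only the restriction to
      \<open>C\<close> matters. Outside \<open>C\<close> both functions are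
      \<open>undefined\<close>; on \<open>C\<close> they agree by
      \<open>central_rank_eq\<close>.\<close>
    have "restrict (restrict (central_rank C rC) (Pow S)) C = rC"
      using semimatroid_extensional[OF sm] central_rank_eq[OF sm] semimatroid_subset[OF sm]
      by (intro extensionalityI[of _ C]) (auto simp: PiE_def)
    then show ?thesis by (simp add: A to_MatId_eq del: to_MatId.simps)
  qed
  have 4: "to_MatId (to_Semimat B) = B" if B: "B \<in> MatId S" for B
  proof -
    obtain r I where B: "B = ((S, r), I)" and M: "matroid S r" and I: "modular_ideal S r I"
      using B by (auto simp: MatId_def)
    \<comment> \<open>Both functions are \<open>undefined\<close> outside \<open>Pow S\<close>, so
      agreement on subsets of \<open>S\<close> suffices.\<close>
    have "restrict (central_rank I (restrict r I)) (Pow S) = r"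
      using matroid_extensional[OF M] central_rank_modular_ideal[OF M I]
      by (intro extensionalityI[of _ "Pow S"]) (auto simp: PiE_def)
    then show ?thesis by (simp add: B to_MatId_eq del: to_MatId.simps)
  qed
  have "bij_betw to_MatId (Semimat S) (MatId S)"
    by (intro bij_betw_byWitness[where f' = to_Semimat] ballI 3 4)
      (use 1 2 in \<open>simp_all only: image_subset_iff_funcset\<close>)
  moreover have "bij_betw to_Semimat (MatId S) (Semimat S)"
    by (intro bij_betw_byWitness[where f' = to_MatId] ballI 3 4)
      (use 1 2 in \<open>simp_all only: image_subset_iff_funcset\<close>)
  ultimately show ?thesis by (intro conjI ballI 1 2 3 4)
qed

end
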